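(* The sequence $(M_n)_{n\ge0}$ of Motzkin numbers is log-convex, i.e. $M_n^2\le M_{n-1}M_{n+1}$ for all $n\ge1$.
   Context: A Motzkin path of length $n$ is a lattice path that starts at $(0,0)$, ends at $(n,0)$, uses steps $U=[1,1]$, $D=[1,-1]$, $H=[1,0]$, and never goes below the $x$-axis. The $n$th Motzkin number $M_n$ is the number of Motzkin paths of length $n$. *)

theory Defs
  imports Complex_Main "HOL-Library.Product_Plus"
begin

datatype step = Up | Down | Horiz

fun step_vec :: "step \<Rightarrow> int \<times> int" where
  "step_vec Up = (1, 1)"
| "step_vec Down = (1, -1)"
| "step_vec Horiz = (1, 0)"

(* A lattice path starting at the origin is represented by its list of steps;
   its vertices are the endpoints of the prefixes of the list. *)
definition endpoint :: "step list \<Rightarrow> int \<times> int" where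
  "endpoint p = sum_list (map step_vec p)"

definition motzkin_path :: "nat \<Rightarrow> step list \<Rightarrow> bool" where
  "motzkin_path n p \<longleftrightarrow>
     endpoint p = (int n, 0) \<and> (\<forall>k \<le> length p. snd (endpoint (take k p)) \<ge> 0)"

definition motzkin_number :: "nat \<Rightarrow> nat" where
  "motzkin_number n = card {p. motzkin_path n p}"

definition log_convex :: "(nat \<Rightarrow> real) \<Rightarrow> bool" where
  "log_convex a \<longleftrightarrow> (\<forall>n\<ge>1. (a n)\<^sup>2 \<le> a (n - 1) * a (n + 1))"

lemma fst_endpoint: "fst (endpoint p) = int (length p)"
proof (induction p)
  case Nil
  show ?case by (simp add: endpoint_def)
next
  case (Cons s p)
  then show ?case by (cases s) (simp_all add: endpoint_def)
qed

lemma motzkin_path_length: "motzkin_path n p \<Longrightarrow> length p = n"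
  using fst_endpoint[of p] by (simp add: motzkin_path_def)

(* Hence the cardinality in motzkin_number is that of a finite set. *)
lemma finite_motzkin_paths: "finite {p. motzkin_path n p}"
proof (rule finite_subset)
  show "{p. motzkin_path n p} \<subseteq> {p. set p \<subseteq> {Up, Down, Horiz} \<and> length p = n}"
    using motzkin_path_length step.exhaust by blast
  show "finite {p. set p \<subseteq> {Up, Down, Horiz} \<and> length p = n}"
    by (rule finite_lists_length_eq) simp
qed

end

theory Submission
  imports Defs
begin

text \<open>
  Let \<open>N l h\<close> count the paths with \<open>l\<close> steps that lead from height \<open>h\<close> down to the axis without
  going below it.  Removing the first step gives the row \<open>N (l + 1)\<close> as the image of the row
  \<open>N l\<close> under the tridiagonal matrix all of whose entries on the three diagonals are 1.  All
  \<open>2 \<times> 2\<close> minors of that matrix are nonnegative, so (Cauchy-Binet) it preserves the property of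
  a pair of rows that their \<open>2 \<times> 2\<close> minors are nonnegative.  The pair \<open>N 0\<close>, \<open>N 1\<close> has
  this property, hence so has every pair \<open>N l\<close>, \<open>N (l + 1)\<close>
  (\<open>num_paths_minor_nonneg\<close>): where \<open>N l h\<close> is positive, the ratio
  \<open>N (l + 1) h / N l h\<close> never decreases as \<open>h\<close> grows.

  Log-convexity is the comparison of the heights 0 and 1.  Since \<open>M\<^sub>n = N n 0\<close> and a path
  from height 0 starts with a step to height 0 or 1, the difference
  \<open>M\<^sub>n\<^sub>-\<^sub>1 M\<^sub>n\<^sub>+\<^sub>1 - M\<^sub>n\<^sup>2\<close> equals
  \<open>N (n - 1) 0 * (N n 0 + N n 1) - (N (n - 1) 0 + N (n - 1) 1) * N n 0\<close>.  The first products
  cancel and leave the minor of the rows \<open>N (n - 1)\<close>, \<open>N n\<close> at the heights 0 and 1.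
\<close>

text \<open>
  Heights are integers, so that the first-step recursion has the same shape at height 0 as at
  positive heights: a step below the axis contributes the empty set.
\<close>

definition paths_from :: "nat \<Rightarrow> int \<Rightarrow> step list set" where
  "paths_from l h = {p. length p = l \<and> h + snd (endpoint p) = 0 \<and>
     (\<forall>k\<le>length p. 0 \<le> h + snd (endpoint (take k p)))}"

definition num_paths :: "nat \<Rightarrow> int \<Rightarrow> nat" where
  "num_paths l h = card (paths_from l h)"

lemma motzkin_number_eq: "motzkin_number n = num_paths n 0"
proof -
  have "{p. motzkin_path n p} = paths_from n 0"
    by (auto simp: motzkin_path_def paths_from_def prod_eq_iff fst_endpoint)
  then show ?thesis
    by (simp add: motzkin_number_def num_paths_def)
qed

lemma endpoint_Nil [simp]: "endpoint [] = 0"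
  by (simp add: endpoint_def)

lemma endpoint_Cons [simp]: "endpoint (s # p) = step_vec s + endpoint p"
  by (simp add: endpoint_def)

lemma finite_paths_from: "finite (paths_from l h)"
proof (rule finite_subset)
  show "paths_from l h \<subseteq> {p. set p \<subseteq> {Up, Down, Horiz} \<and> length p = l}"
    using step.exhaust by (auto simp: paths_from_def)
  show "finite {p. set p \<subseteq> {Up, Down, Horiz} \<and> length p = l}"
    by (rule finite_lists_length_eq) simp
qed

lemma num_paths_neg:
  assumes "h < 0"
  shows "num_paths l h = 0"
proof -
  have False if "p \<in> paths_from l h" for p
  proof -
    have "0 \<le> h + snd (endpoint (take 0 p))"
      using that unfolding paths_from_def by blast
    with \<open>h < 0\<close> show False by simp
  qed
  then have "paths_from l h = {}" by blast
  then show ?thesis by (simp add: num_paths_def)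
qed

lemma num_paths_0: "num_paths 0 h = (if h = 0 then 1 else 0)"
proof -
  have "paths_from 0 h = (if h = 0 then {[]} else {})"
    by (auto simp: paths_from_def)
  then show ?thesis
    by (simp add: num_paths_def)
qed

lemma Cons_in_paths_from_iff:
  assumes "0 \<le> h"
  shows "s # p \<in> paths_from (Suc l) h \<longleftrightarrow> p \<in> paths_from l (h + snd (step_vec s))"
proof -
  have "(\<forall>k\<le>length (s # p). 0 \<le> h + snd (endpoint (take k (s # p)))) \<longleftrightarrow>
        (\<forall>k\<le>length p. 0 \<le> h + snd (step_vec s) + snd (endpoint (take k p)))"
    (is "?L \<longleftrightarrow> ?R")
  proof
    show "?R" if ?L
    proof (intro allI impI)
      fix k assume "k \<le> length p"
      with that[rule_format, of "Suc k"]
      show "0 \<le> h + snd (step_vec s) + snd (endpoint (take k p))"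
        by (simp add: add.assoc)
    qed
    show "?L" if ?R
    proof (intro allI impI)
      fix k assume "k \<le> length (s # p)"
      with that assms show "0 \<le> h + snd (endpoint (take k (s # p)))"
        by (cases k) (auto simp: add.assoc)
    qed
  qed
  then show ?thesis
    by (auto simp: paths_from_def add.assoc)
qed

lemma num_paths_Suc:
  assumes "0 \<le> h"
  shows "num_paths (Suc l) h = num_paths l (h - 1) + num_paths l h + num_paths l (h + 1)"
proof -
  let ?D = "(#) Down ` paths_from l (h - 1)"
  let ?H = "(#) Horiz ` paths_from l h"
  let ?U = "(#) Up ` paths_from l (h + 1)"
  have split: "p \<in> paths_from (Suc l) h \<longleftrightarrow> p \<in> ?D \<union> ?H \<union> ?U" for p
  proof (cases p)
    case Nil
    then show ?thesis by (auto simp: paths_from_def)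
  next
    case (Cons s q)
    then show ?thesis
      by (cases s) (auto simp: Cons_in_paths_from_iff[OF assms])
  qed
  have "paths_from (Suc l) h = (?D \<union> ?H) \<union> ?U"
    by (rule set_eqI) (rule split)
  then have "num_paths (Suc l) h = card ((?D \<union> ?H) \<union> ?U)"
    by (simp add: num_paths_def)
  also have "\<dots> = card (?D \<union> ?H) + card ?U"
    by (rule card_Un_disjoint) (auto simp: finite_paths_from)
  also have "card (?D \<union> ?H) = card ?D + card ?H"
    by (rule card_Un_disjoint) (auto simp: finite_paths_from)
  finally show ?thesis
    by (simp add: num_paths_def card_image)
qed

text \<open>
  The tridiagonal matrix of ones preserves nonnegativity of \<open>2 \<times> 2\<close> minors.  Unless \<open>i\<close>
  and \<open>j\<close> are adjacent, every index in the window around \<open>i\<close> is at most every index in the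
  window around \<open>j\<close>, and the nine products compare termwise.  If \<open>j = i + 1\<close>, the windows
  share \<open>i\<close> and \<open>i + 1\<close>; the four products formed from these two indices alone occur on both
  sides and cancel, and the other five compare termwise.
\<close>

lemma window_sums_minor_nonneg:
  fixes u w :: "int \<Rightarrow> nat"
  assumes minor: "\<And>i j. i \<le> j \<Longrightarrow> u j * w i \<le> u i * w j"
    and "i < j"
  shows "(u (j - 1) + u j + u (j + 1)) * (w (i - 1) + w i + w (i + 1))
       \<le> (u (i - 1) + u i + u (i + 1)) * (w (j - 1) + w j + w (j + 1))"
proof (cases "j = i + 1")
  case True
  have shift: "j - 1 = i" "j + 1 = i + 2"
    using True by auto
  have "u i * w (i - 1) \<le> u (i - 1) * w i"
    "u (i + 1) * w (i - 1) \<le> u (i - 1) * w (i + 1)"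
    "u (i + 2) * w (i - 1) \<le> u (i - 1) * w (i + 2)"
    "u (i + 2) * w i \<le> u i * w (i + 2)"
    "u (i + 2) * w (i + 1) \<le> u (i + 1) * w (i + 2)"
    by (auto intro: minor)
  then show ?thesis
    unfolding shift unfolding True distrib_left distrib_right by linarith
next
  case False
  have "u b * w a \<le> u a * w b" if "a \<in> {i - 1, i, i + 1}" "b \<in> {j - 1, j, j + 1}" for a b
    by (rule minor) (use that False \<open>i < j\<close> in auto)
  then have "u (j - 1) * w (i - 1) \<le> u (i - 1) * w (j - 1)"
    "u (j - 1) * w i \<le> u i * w (j - 1)"
    "u (j - 1) * w (i + 1) \<le> u (i + 1) * w (j - 1)"
    "u j * w (i - 1) \<le> u (i - 1) * w j"
    "u j * w i \<le> u i * w j"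
    "u j * w (i + 1) \<le> u (i + 1) * w j"
    "u (j + 1) * w (i - 1) \<le> u (i - 1) * w (j + 1)"
    "u (j + 1) * w i \<le> u i * w (j + 1)"
    "u (j + 1) * w (i + 1) \<le> u (i + 1) * w (j + 1)"
    by blast+
  then show ?thesis
    unfolding distrib_left distrib_right by linarith
qed

lemma num_paths_minor_nonneg:
  "i \<le> j \<Longrightarrow> num_paths l j * num_paths (Suc l) i \<le> num_paths l i * num_paths (Suc l) j"
proof (induction l arbitrary: i j)
  case 0
  show ?case
  proof (cases "j = 0")
    case True
    with 0 show ?thesis by (cases "i = 0") (auto simp: num_paths_neg)
  next
    case False
    then show ?thesis by (simp add: num_paths_0)
  qed
next
  case (Suc l)
  consider "i < 0" | "i = j" | "0 \<le> i" "i < j"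
    using Suc.prems by linarith
  then show ?case
  proof cases
    case 3
    then show ?thesis
      using window_sums_minor_nonneg[of "num_paths l" "num_paths (Suc l)", OF Suc.IH \<open>i < j\<close>]
      by (simp only: num_paths_Suc[of _ l] num_paths_Suc[of _ "Suc l"])
  qed (simp_all add: num_paths_neg)
qed

theorem theorem2p2:
  shows "log_convex (\<lambda>n. real (motzkin_number n))"
  unfolding log_convex_def
proof (intro allI impI)
  fix n :: nat
  assume "1 \<le> n"
  then obtain m where n: "n = Suc m"
    by (cases n) auto
  have first_step: "num_paths (Suc l) 0 = num_paths l 0 + num_paths l 1" for l
    by (simp add: num_paths_Suc num_paths_neg)
  have "num_paths n 0 * num_paths n 0 = num_paths m 0 * num_paths n 0 + num_paths m 1 * num_paths n 0"
    using first_step[of m] by (simp add: n algebra_simps)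
  also have "\<dots> \<le> num_paths m 0 * num_paths n 0 + num_paths m 0 * num_paths n 1"
    using num_paths_minor_nonneg[of 0 1 m] by (simp add: n)
  also have "\<dots> = num_paths m 0 * num_paths (Suc n) 0"
    by (simp add: first_step[of n] algebra_simps)
  finally have "(motzkin_number n)\<^sup>2 \<le> motzkin_number m * motzkin_number (Suc n)"
    by (simp add: motzkin_number_eq power2_eq_square)
  then have "real ((motzkin_number n)\<^sup>2) \<le> real (motzkin_number m * motzkin_number (Suc n))"
    by (rule of_nat_mono)
  then show "(real (motzkin_number n))\<^sup>2 \<le> real (motzkin_number (n - 1)) * real (motzkin_number (n + 1))"
    by (simp add: n)
qed

end
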